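(* Let $n\ge 2$ and let $G$ be a graph on $n$ vertices with $m$ edges such that \[\frac{1}{\sqrt{n} -1} \le \frac{m}{\binom{n}{2}}.\] Then $S(G)\geq H_2(G)\geq S(K_{1,n-1})$. Moreover, as $n\to\infty$, almost all graphs satisfy this density condition, i.e. the proportion of labeled graphs on the vertex set $\{1,\dots,n\}$ with $m/\binom n2\ge \frac{1}{\sqrt n-1}$ tends to $1$.
   Context: For a graph $G$ with at least one edge, let $L(G)=D(G)-A(G)$ be its combinatorial Laplacian and $\rho(G)=\frac{1}{\operatorname{tr}L(G)}L(G)$, with eigenvalues $\lambda_1,\dots,\lambda_n$ (with multiplicity). The von Neumann entropy is $S(G)=-\sum_i\lambda_i\log_2\lambda_i$ (with $0\log_2 0:=0$), and the R\'enyi 2-entropy is $H_2(G)=-\log_2\sum_i\lambda_i^2$. $K_{1,n-1}$ is the star on $n$ vertices. *)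

theory Defs
  imports Complex_Main "Jordan_Normal_Form.Char_Poly"
begin

definition simple_graph :: "'a set \<Rightarrow> 'a set set \<Rightarrow> bool" where
  "simple_graph V E \<longleftrightarrow> finite V \<and> E \<subseteq> {e. e \<subseteq> V \<and> card e = 2}"

definition vertex_degree :: "'a set set \<Rightarrow> 'a \<Rightarrow> nat" where
  "vertex_degree E v = card {e \<in> E. v \<in> e}"

(* The matrices of a graph depend on an ordering of its vertices. It is given by a list vs that
   contains every vertex exactly once; row and column i belong to the vertex vs ! i. *)

definition degree_matrix :: "'a list \<Rightarrow> 'a set set \<Rightarrow> real mat" where
  "degree_matrix vs E = mat (length vs) (length vs)
     (\<lambda>(i, j). if i = j then real (vertex_degree E (vs ! i)) else 0)"

definition adjacency_matrix :: "'a list \<Rightarrow> 'a set set \<Rightarrow> real mat" where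
  "adjacency_matrix vs E = mat (length vs) (length vs)
     (\<lambda>(i, j). if {vs ! i, vs ! j} \<in> E then 1 else 0)"

definition laplacian :: "'a list \<Rightarrow> 'a set set \<Rightarrow> real mat" where
  "laplacian vs E = degree_matrix vs E - adjacency_matrix vs E"

definition mat_trace :: "real mat \<Rightarrow> real" where
  "mat_trace A = (\<Sum>i<dim_row A. A $$ (i, i))"

definition density_matrix :: "'a list \<Rightarrow> 'a set set \<Rightarrow> real mat" where
  "density_matrix vs E = (1 / mat_trace (laplacian vs E)) \<cdot>\<^sub>m laplacian vs E"

(* Eigenvalues with algebraic multiplicity. The density matrix is real symmetric, so its
   characteristic polynomial splits over the reals and this multiset has length vs elements. *)
definition graph_eigenvalues :: "'a list \<Rightarrow> 'a set set \<Rightarrow> real multiset" where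
  "graph_eigenvalues vs E = proots (char_poly (density_matrix vs E))"

(* The convention for the eigenvalue 0 holds because 0 * log 2 0 = 0. *)
definition von_neumann_entropy :: "'a list \<Rightarrow> 'a set set \<Rightarrow> real" where
  "von_neumann_entropy vs E = - (\<Sum>x\<in>#graph_eigenvalues vs E. x * log 2 x)"

definition renyi_2_entropy :: "'a list \<Rightarrow> 'a set set \<Rightarrow> real" where
  "renyi_2_entropy vs E = - log 2 (\<Sum>x\<in>#graph_eigenvalues vs E. x\<^sup>2)"

definition star_edges :: "nat \<Rightarrow> nat set set" where
  "star_edges n = {{1, v} | v. v \<in> {2..n}}"

definition density_condition :: "nat \<Rightarrow> nat \<Rightarrow> bool" where
  "density_condition n m \<longleftrightarrow> 1 / (sqrt (real n) - 1) \<le> real m / real (n choose 2)"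

end

theory Submission
  imports Defs "Jordan_Normal_Form.Schur_Decomposition" "HOL-Real_Asymp.Real_Asymp"
begin

text \<open>
  The inequality between the two entropies is concavity of the logarithm, applied to the probability
  weights \<open>\<lambda>\<^sub>i\<close>. For the comparison with the star, \<open>\<Sum>\<lambda>\<^sub>i\<^sup>2 = (\<Sum>d\<^sub>i\<^sup>2 + 2m) / (2m)\<^sup>2\<close> and de Caen's
  inequality \<open>\<Sum>d\<^sub>i\<^sup>2 \<le> m (2m / (n - 1) + n - 2)\<close> turn the density condition into
  \<open>\<Sum>\<lambda>\<^sub>i\<^sup>2 \<le> \<surd>n / (2 (n - 1))\<close>, while
  \<open>S(K\<^sub>1\<^sub>,\<^sub>n\<^sub>-\<^sub>1) = log (2 (n - 1)) - n / (2 (n - 1)) log n \<le> log (2 (n - 1)) - log n / 2\<close>.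
  A graph violating the density condition has, once \<open>n \<ge> 16\<close>, fewer than a third of all possible
  edges; by Chebyshev's inequality the proportion of such graphs is at most \<open>9 / (n choose 2)\<close>.
\<close>

subsection \<open>Spectra of real symmetric matrices\<close>

lemma mat_trace_mult_commute:
  assumes A: "A \<in> carrier_mat n n" and B: "B \<in> carrier_mat n n"
  shows "mat_trace (A * B) = mat_trace (B * A)"
proof -
  have "mat_trace (A * B) = (\<Sum>i<n. \<Sum>j<n. A $$ (i,j) * B $$ (j,i))"
    using A B by (auto simp: mat_trace_def scalar_prod_def lessThan_atLeast0 intro!: sum.cong)
  also have "\<dots> = (\<Sum>j<n. \<Sum>i<n. B $$ (j,i) * A $$ (i,j))"
    by (subst sum.swap) (simp add: mult.commute)
  also have "\<dots> = mat_trace (B * A)"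
    using A B by (auto simp: mat_trace_def scalar_prod_def lessThan_atLeast0 intro!: sum.cong)
  finally show ?thesis .
qed

lemma mat_trace_similar:
  assumes A: "A \<in> carrier_mat n n" and "similar_mat_wit A B P Q"
  shows "mat_trace A = mat_trace B"
proof -
  note w = similar_mat_witD2[OF assms]
  have "mat_trace A = mat_trace (P * (B * Q))"
    using w by (metis assoc_mult_mat)
  also have "\<dots> = mat_trace (B * Q * P)"
    using w by (intro mat_trace_mult_commute[of _ n]) auto
  also have "B * Q * P = B"
    using w by (metis assoc_mult_mat right_mult_one_mat)
  finally show ?thesis .
qed

lemma similar_mat_wit_square:
  assumes A: "A \<in> carrier_mat n n" and "similar_mat_wit A B P Q"
  shows "similar_mat_wit (A * A) (B * B) P Q"
proof -
  note w = similar_mat_witD2[OF assms]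
  show ?thesis
    using similar_mat_wit_pow[OF assms(2), of 2] w A
    by (simp add: numeral_2_eq_2 left_mult_one_mat[of _ n n])
qed

text \<open>In the expansion of the diagonal entry, each term with \<open>j < i\<close> has its
  first factor below the diagonal and each term with \<open>j > i\<close> its second, so only
  \<open>j = i\<close> survives.\<close>

lemma upper_triangular_square_diag:
  fixes B :: "'a :: comm_ring_1 mat"
  assumes B: "B \<in> carrier_mat n n" and up: "upper_triangular B" and i: "i < n"
  shows "(B * B) $$ (i, i) = (B $$ (i, i))\<^sup>2"
proof -
  have "(B * B) $$ (i, i) = (\<Sum>j<n. B $$ (i,j) * B $$ (j,i))"
    using B i by (auto simp: scalar_prod_def lessThan_atLeast0 intro!: sum.cong)
  also have "\<dots> = (\<Sum>j<n. if j = i then (B $$ (i,i))\<^sup>2 else 0)"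
  proof (rule sum.cong[OF refl])
    fix j assume "j \<in> {..<n}"
    then show "B $$ (i,j) * B $$ (j,i) = (if j = i then (B $$ (i,i))\<^sup>2 else 0)"
      using up B i by (cases j i rule: linorder_cases)
        (auto simp: power2_eq_square upper_triangularD)
  qed
  finally show ?thesis using i by simp
qed

text \<open>The Hermitian form \<open>T\<close> = v* A v equals \<open>k * S\<close>, where
  \<open>S\<close> is the squared norm of \<open>v\<close>. Conjugating \<open>T\<close> and
  swapping the two sums returns \<open>T\<close> because \<open>A\<close> is real and symmetric, so
  \<open>T\<close> is real; and \<open>S\<close> is nonzero.\<close>

lemma symmetric_complex_eigenvalue_real:
  fixes A :: "real mat"
  assumes A: "A \<in> carrier_mat n n" and sym: "transpose_mat A = A"
    and ev: "eigenvector (map_mat complex_of_real A) v k"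
  shows "Im k = 0"
proof -
  have v: "dim_vec v = n" "v \<noteq> 0\<^sub>v n" and eq: "map_mat complex_of_real A *\<^sub>v v = k \<cdot>\<^sub>v v"
    using ev A by (auto simp: eigenvector_def)
  have symA: "A $$ (i,j) = A $$ (j,i)" if "i < n" "j < n" for i j
    using arg_cong[OF sym, of "\<lambda>M. M $$ (i,j)"] that A by auto
  have row: "(\<Sum>j<n. of_real (A $$ (i,j)) * v $ j) = k * v $ i" if "i < n" for i
    using arg_cong[OF eq, of "\<lambda>w. w $ i"] that A v
    by (auto simp: scalar_prod_def lessThan_atLeast0)
  define S where "S = (\<Sum>i<n. (cmod (v $ i))\<^sup>2)"
  define T where "T = (\<Sum>i<n. cnj (v $ i) * (\<Sum>j<n. of_real (A $$ (i,j)) * v $ j))"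
  have "T = (\<Sum>i<n. k * of_real ((cmod (v $ i))\<^sup>2))"
    unfolding T_def
    by (intro sum.cong refl) (simp only: row lessThan_iff, simp only: complex_norm_square mult_ac)
  then have T: "T = k * of_real S"
    by (simp add: S_def sum_distrib_left)
  have "cnj T = (\<Sum>i<n. \<Sum>j<n. v $ i * of_real (A $$ (i,j)) * cnj (v $ j))"
    by (simp add: T_def sum_distrib_left mult_ac)
  also have "\<dots> = (\<Sum>j<n. \<Sum>i<n. v $ i * of_real (A $$ (i,j)) * cnj (v $ j))"
    by (rule sum.swap)
  also have "\<dots> = T"
    unfolding T_def sum_distrib_left
    by (intro sum.cong refl) (simp add: symA mult_ac)
  finally have "Im T = 0"
    by (simp add: complex_eq_iff)
  then have "Im k * S = 0" using T by simp
  moreover have "S \<noteq> 0"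
  proof
    assume "S = 0"
    then have "\<forall>i\<in>{..<n}. (cmod (v $ i))\<^sup>2 = 0"
      unfolding S_def by (subst (asm) sum_nonneg_eq_0_iff) auto
    then have "v = 0\<^sub>v n" using v by (intro eq_vecI) auto
    then show False using v by simp
  qed
  ultimately show ?thesis by simp
qed

lemma map_poly_prod_list_linear:
  "map_poly complex_of_real (\<Prod>e\<leftarrow>es. [:- e, 1:]) = (\<Prod>e\<leftarrow>es. [:- complex_of_real e, 1:])"
proof -
  interpret map_poly_comm_ring_hom complex_of_real ..
  show ?thesis by (induction es) (simp_all add: hom_mult del: mult_pCons_left)
qed

text \<open>Factor over the complex numbers: every root is an eigenvalue of the complexified matrix
  and hence real. Since the embedding of the reals is injective on coefficients, the factorization
  descends.\<close>

lemma symmetric_char_poly_splits: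
  fixes A :: "real mat"
  assumes A: "A \<in> carrier_mat n n" and sym: "transpose_mat A = A"
  obtains es where "char_poly A = (\<Prod>e\<leftarrow>es. [:- e, 1:])"
proof -
  let ?C = "map_mat complex_of_real A"
  have C: "?C \<in> carrier_mat n n" using A by simp
  obtain as where as: "char_poly ?C = (\<Prod>a\<leftarrow>as. [:- a, 1:])"
    using char_poly_factorized[OF C] by blast
  have real: "complex_of_real (Re a) = a" if "a \<in> set as" for a
  proof -
    have "poly (char_poly ?C) a = 0"
      using that unfolding as poly_prod_list by (auto simp: image_iff intro!: bexI[of _ a])
    then obtain v where "eigenvector ?C v a"
      using eigenvalue_root_char_poly[OF C] by (auto simp: eigenvalue_def)
    from symmetric_complex_eigenvalue_real[OF A sym this]
    show ?thesis by (simp add: complex_eq_iff)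
  qed
  have "map_poly complex_of_real (char_poly A) = char_poly ?C"
    by (rule of_real_hom.char_poly_hom[OF A, symmetric])
  also have "\<dots> = (\<Prod>e\<leftarrow>map Re as. [:- complex_of_real e, 1:])"
    unfolding as map_map using real by (intro arg_cong[of _ _ prod_list] map_cong) auto
  also have "\<dots> = map_poly complex_of_real (\<Prod>e\<leftarrow>map Re as. [:- e, 1:])"
    by (rule map_poly_prod_list_linear[symmetric])
  finally have "char_poly A = (\<Prod>e\<leftarrow>map Re as. [:- e, 1:])"
    by (auto simp: poly_eq_iff coeff_map_poly)
  then show thesis by (rule that)
qed

lemma proots_prod_list_linear:
  fixes es :: "'a :: field list"
  shows "proots (\<Prod>e\<leftarrow>es. [:- e, 1:]) = mset es"
proof (induction es)
  case (Cons e es)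
  have "(\<Prod>e\<leftarrow>es. [:- e, 1:]) \<noteq> 0" by auto
  then have "proots ([:- e, 1:] * (\<Prod>e\<leftarrow>es. [:- e, 1:])) = proots [:- e, 1:] + mset es"
    by (subst proots_mult) (auto simp: Cons.IH)
  then show ?case by (simp del: mult_pCons_left)
qed simp

text \<open>Schur triangularization puts the roots on the diagonal of a matrix \<open>B\<close>
  similar to \<open>A\<close>. The two sums are then the traces of \<open>B\<close> and
  \<open>B * B\<close>, which similarity turns into those of \<open>A\<close> and
  \<open>A * A\<close>; by symmetry the latter is the squared Frobenius norm.\<close>

lemma symmetric_proots_sums:
  fixes A :: "real mat"
  assumes A: "A \<in> carrier_mat n n" and sym: "transpose_mat A = A"
  shows "(\<Sum>x\<in>#proots (char_poly A). x) = mat_trace A"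
    and "(\<Sum>x\<in>#proots (char_poly A). x\<^sup>2) = (\<Sum>i<n. \<Sum>j<n. (A $$ (i,j))\<^sup>2)"
proof -
  obtain es where es: "char_poly A = (\<Prod>e\<leftarrow>es. [:- e, 1:])"
    by (rule symmetric_char_poly_splits[OF A sym])
  obtain B P Q where "schur_decomposition A es = (B, P, Q)"
    by (cases "schur_decomposition A es") auto
  from schur_decomposition[OF A es this]
  have wit: "similar_mat_wit A B P Q" and up: "upper_triangular B" and diag: "diag_mat B = es"
    by auto
  have B: "B \<in> carrier_mat n n" using similar_mat_witD2[OF A wit] by simp
  have roots: "proots (char_poly A) = mset es"
    unfolding es by (rule proots_prod_list_linear)
  have sums: "(\<Sum>x\<in>#proots (char_poly A). f x) = (\<Sum>i<n. f (B $$ (i,i)))" for f :: "real \<Rightarrow> real"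
    using B unfolding roots diag[symmetric]
    by (simp add: diag_mat_def comp_def sum_mset_sum_list[symmetric] flip: mset_map)
      (simp add: sum_unfold_sum_mset lessThan_atLeast0)
  have "(\<Sum>x\<in>#proots (char_poly A). x) = mat_trace B"
    using sums[of "\<lambda>x. x"] B by (simp add: mat_trace_def)
  then show "(\<Sum>x\<in>#proots (char_poly A). x) = mat_trace A"
    by (simp add: mat_trace_similar[OF A wit])
  have "(\<Sum>x\<in>#proots (char_poly A). x\<^sup>2) = mat_trace (B * B)"
    using B by (simp add: sums mat_trace_def upper_triangular_square_diag[OF B up] del: index_mult_mat(1))
  also have "\<dots> = mat_trace (A * A)"
    using A by (intro mat_trace_similar[symmetric, OF _ similar_mat_wit_square[OF A wit]]) auto
  also have "\<dots> = (\<Sum>i<n. \<Sum>j<n. A $$ (i,j) * A $$ (j,i))"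
    using A by (auto simp: mat_trace_def scalar_prod_def lessThan_atLeast0 intro!: sum.cong)
  also have "\<dots> = (\<Sum>i<n. \<Sum>j<n. (A $$ (i,j))\<^sup>2)"
  proof (intro sum.cong refl)
    fix i j assume "i \<in> {..<n}" "j \<in> {..<n}"
    then have "A $$ (j,i) = A $$ (i,j)"
      using arg_cong[OF sym, of "\<lambda>M. M $$ (i,j)"] A by auto
    then show "A $$ (i,j) * A $$ (j,i) = (A $$ (i,j))\<^sup>2" by (simp add: power2_eq_square)
  qed
  finally show "(\<Sum>x\<in>#proots (char_poly A). x\<^sup>2) = (\<Sum>i<n. \<Sum>j<n. (A $$ (i,j))\<^sup>2)" .
qed

lemma in_proots_char_poly_eigenvector:
  fixes A :: "real mat"
  assumes A: "A \<in> carrier_mat n n" and "x \<in># proots (char_poly A)"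
  obtains v where "eigenvector A v x"
proof -
  have "char_poly A \<noteq> 0" using degree_monic_char_poly[OF A] by auto
  then have "poly (char_poly A) x = 0" using assms(2) by simp
  then show thesis using that eigenvalue_root_char_poly[OF A] by (auto simp: eigenvalue_def)
qed

subsection \<open>De Caen's inequality\<close>

text \<open>The numerical core of the local bound at a vertex: \<open>d\<close> stands for its
  degree, \<open>s\<close> for the sum of its neighbours' degrees, \<open>N\<close> for the number
  of other vertices and \<open>M\<close> for the sum of all degrees.\<close>

lemma neighbour_degree_arith:
  fixes N s M :: real and k :: nat
  defines "d \<equiv> real k"
  assumes "d \<le> N" "0 \<le> s" "s \<le> d * N" "d + s \<le> M" "d + 2 * s - d\<^sup>2 \<le> M" "N \<in> \<int>"
  shows "N * (d\<^sup>2 + s) \<le> d * (M + N * (N - 1))"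
proof (cases "k = 0")
  case True
  then show ?thesis using assms by simp
next
  case False
  then have d1: "d \<ge> 1" by (simp add: d_def)
  show ?thesis
  proof (cases "N \<le> 2 * d")
    case True
    \<comment> \<open>The last upper bound on \<open>s\<close>, in the form
      \<open>s - d\<^sup>2 \<le> M - d - s\<close>, is weighted with \<open>N - d\<close>. As
      \<open>M - d - s\<close> is nonnegative and \<open>N - d \<le> d\<close> in this case, the
      weight on the right may then be raised to \<open>d\<close>.\<close>
    have "(N - d) * (s - d\<^sup>2) \<le> (N - d) * (M - d - s)"
      using assms by (intro mult_left_mono) auto
    also have "\<dots> \<le> d * (M - d - s)"
      using assms True by (intro mult_right_mono) auto
    finally have 1: "(N - d) * (s - d\<^sup>2) \<le> d * (M - d - s)" .
    \<comment> \<open>What remains is \<open>N - d \<le> (N - d)\<^sup>2\<close>, which fails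
      strictly between 0 and 1 and so rests on integrality.\<close>
    have "N - d \<in> \<int>" using \<open>N \<in> \<int>\<close> by (simp add: d_def)
    then obtain z :: int where z: "N - d = of_int z" by (elim Ints_cases)
    have "z \<le> z\<^sup>2"
      using mult_left_mono[of 1 z z] by (cases "z \<le> 0") (auto simp: power2_eq_square intro: order_trans)
    then have "of_int z \<le> (of_int (z\<^sup>2) :: real)" by (simp only: of_int_le_iff)
    then have "N - d \<le> (N - d)\<^sup>2" by (simp add: z)
    then have "d * (N - d) \<le> d * (N - d)\<^sup>2" using d1 by (intro mult_left_mono) auto
    with 1 show ?thesis by (simp add: algebra_simps power2_eq_square)
  next
    case False
    \<comment> \<open>The weights \<open>d\<close> and \<open>N - 2 * d\<close> are chosen so that
      \<open>s\<close> gets total coefficient \<open>2 * d + (N - 2 * d) = N\<close>. The slack left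
      over is the third product.\<close>
    have "d * (d + 2 * s - d\<^sup>2) \<le> d * M"
      using assms d1 by (intro mult_left_mono) auto
    moreover have "(N - 2 * d) * s \<le> (N - 2 * d) * (d * N)"
      using assms False by (intro mult_left_mono) auto
    moreover have "0 \<le> d * ((d - 1) * (N - d))" using d1 assms by simp
    ultimately show ?thesis by (simp add: algebra_simps power2_eq_square)
  qed
qed

context
  fixes a :: "nat \<Rightarrow> nat \<Rightarrow> real" and n :: nat and d :: "nat \<Rightarrow> real" and M :: real
  assumes sym: "\<And>i j. a i j = a j i"
    and zero_one: "\<And>i j. a i j = 0 \<or> a i j = 1"
    and diag: "\<And>i. a i i = 0"
    and d: "\<And>i. d i = (\<Sum>j<n. a i j)"
    and M: "M = (\<Sum>i<n. d i)"
begin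

text \<open>Here \<open>a\<close> plays the role of an adjacency matrix. Two estimates of the
  neighbour degree sum feed \<open>neighbour_degree_arith\<close>: \<open>v\<close> and its
  neighbours are distinct vertices, so their degrees sum to at most \<open>M\<close>; and the sum
  counts walks of length two from \<open>v\<close>, bounded endpoint by endpoint.\<close>

lemma degree_plus_neighbour_degrees_le:
  assumes v: "v < n"
  shows "(real n - 1) * ((d v)\<^sup>2 + (\<Sum>u<n. a v u * d u))
           \<le> d v * (M + (real n - 1) * (real n - 1 - 1))"
proof -
  let ?s = "\<Sum>u<n. a v u * d u"
  have a0: "0 \<le> a i j" and a1: "a i j \<le> 1" for i j using zero_one[of i j] by auto
  have dN: "d u \<le> real n - 1" if "u < n" for u
  proof -
    have "d u = (\<Sum>j\<in>{..<n} - {u}. a u j)"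
      unfolding d using that diag by (subst sum.remove[of _ u]) auto
    also have "\<dots> \<le> (\<Sum>j\<in>{..<n} - {u}. 1)" by (intro sum_mono a1)
    also have "\<dots> = real n - 1" using that by simp
    finally show ?thesis .
  qed
  have d0: "0 \<le> d u" for u unfolding d by (intro sum_nonneg a0)
  have "d v = real (card {u\<in>{..<n}. a v u = 1})"
    unfolding d using zero_one[of v]
    by (subst sum.mono_neutral_right[of _ "{u\<in>{..<n}. a v u = 1}"]) auto
  then obtain k where k: "d v = real k" by blast
  have s0: "0 \<le> ?s" by (intro sum_nonneg mult_nonneg_nonneg a0 d0)
  have "?s \<le> (\<Sum>u<n. a v u * (real n - 1))"
    by (intro sum_mono mult_left_mono dN a0) auto
  then have sN: "?s \<le> d v * (real n - 1)" by (simp add: d sum_distrib_right)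
  have delta: "(\<Sum>w<n. if w = v then f w else 0) = f v" for f :: "nat \<Rightarrow> real"
    using v by simp
  have "d v + ?s = (\<Sum>w<n. (if w = v then d w else 0) + a v w * d w)"
    unfolding sum.distrib delta by simp
  also have "\<dots> \<le> (\<Sum>w<n. d w)"
    using diag[of v] a0 a1 d0 by (intro sum_mono) (auto simp: mult_left_le_one_le)
  finally have sM: "d v + ?s \<le> M" by (simp add: M)
  have "?s = (\<Sum>w<n. \<Sum>u<n. a v u * a u w)"
    unfolding d sum_distrib_left by (rule sum.swap)
  \<comment> \<open>Common neighbours of \<open>v\<close> and \<open>w\<close>: at most
    \<open>d v\<close> if \<open>w = v\<close>; at most \<open>d v - 1\<close> if \<open>w\<close>
    is adjacent to \<open>v\<close>, since \<open>w\<close> is not its own neighbour; at most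
    \<open>d w\<close> otherwise. The summand encodes these three bounds in one expression.\<close>
  also have "\<dots> \<le> (\<Sum>w<n. (if w = v then d v - d w else 0) + (a v w * (d v - 1) + (d w - a v w * d w)))"
  proof (rule sum_mono)
    fix w assume w: "w \<in> {..<n}"
    consider "w = v" | "w \<noteq> v" "a v w = 1" | "w \<noteq> v" "a v w = 0" using zero_one[of v w] by blast
    then show "(\<Sum>u<n. a v u * a u w)
        \<le> (if w = v then d v - d w else 0) + (a v w * (d v - 1) + (d w - a v w * d w))"
    proof cases
      case 1
      have "a v u * a u w \<le> a v u" for u using a1[of u w] a0[of v u] by (simp add: mult_left_le)
      then show ?thesis using 1 diag by (simp add: d sum_mono)
    next
      case 2
      have "(\<Sum>u<n. a v u * a u w) = (\<Sum>u\<in>{..<n} - {w}. a v u * a u w)"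
        using w diag by (subst sum.remove[of _ w]) auto
      also have "\<dots> \<le> (\<Sum>u\<in>{..<n} - {w}. a v u)"
        using a0 a1 by (intro sum_mono mult_left_le)
      also have "\<dots> = d v - 1" using w 2 by (simp add: d sum_diff1)
      finally show ?thesis using 2 by simp
    next
      case 3
      have "(\<Sum>u<n. a v u * a u w) \<le> (\<Sum>u<n. a w u)"
        using a0 a1 by (intro sum_mono) (simp add: sym[of w] mult_left_le_one_le)
      then show ?thesis using 3 by (simp add: d)
    qed
  qed
  also have "\<dots> = (d v * (d v - 1) + (M - ?s))"
    unfolding sum.distrib delta sum_subtractf M by (simp add: d sum_distrib_right)
  finally have "d v + 2 * ?s - (d v)\<^sup>2 \<le> M" by (simp add: algebra_simps power2_eq_square)
  with neighbour_degree_arith[of k "real n - 1" ?s M] s0 sN sM dN[OF v] show ?thesis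
    by (simp add: k)
qed

text \<open>de Caen's inequality, obtained by summing the previous bound over all vertices: both terms
  on its left-hand side then contribute the sum of the squared degrees.\<close>

lemma sum_squared_degrees_le:
  "2 * (real n - 1) * (\<Sum>i<n. (d i)\<^sup>2) \<le> M * (M + (real n - 1) * (real n - 2))"
proof -
  have "(\<Sum>v<n. \<Sum>u<n. a v u * d u) = (\<Sum>u<n. \<Sum>v<n. a u v * d u)"
    by (subst sum.swap) (simp add: sym)
  also have "\<dots> = (\<Sum>u<n. (d u)\<^sup>2)"
    by (simp add: d power2_eq_square sum_distrib_right)
  finally have "2 * (real n - 1) * (\<Sum>i<n. (d i)\<^sup>2)
      = (\<Sum>v<n. (real n - 1) * ((d v)\<^sup>2 + (\<Sum>u<n. a v u * d u)))"
    by (simp add: sum_distrib_left[symmetric] sum.distrib)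
  also have "\<dots> \<le> (\<Sum>v<n. d v * (M + (real n - 1) * (real n - 1 - 1)))"
    by (intro sum_mono degree_plus_neighbour_degrees_le) auto
  also have "\<dots> = M * (M + (real n - 1) * (real n - 2))"
    by (simp add: M sum_distrib_right[symmetric])
  finally show ?thesis .
qed

end

subsection \<open>Spectrum of the density matrix\<close>

locale ordered_graph =
  fixes vs :: "'a list" and E :: "'a set set"
  assumes distinct: "distinct vs" and graph: "simple_graph (set vs) E"
begin

definition n :: nat where "n = length vs"
definition adj :: "nat \<Rightarrow> nat \<Rightarrow> real" where "adj i j = (if {vs ! i, vs ! j} \<in> E then 1 else 0)"
definition deg :: "nat \<Rightarrow> real" where "deg i = (\<Sum>j<n. adj i j)"

section \<open>Degrees and edge counting in terms of vertex indices\<close>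

lemma edge_card: "e \<in> E \<Longrightarrow> e \<subseteq> set vs \<and> card e = 2"
  using graph by (auto simp: simple_graph_def)

lemma finite_edges: "finite E"
  by (rule finite_subset[of _ "Pow (set vs)"]) (use edge_card in auto)

lemma adj_sym: "adj i j = adj j i"
  by (simp add: adj_def insert_commute)

lemma adj_zero_one: "adj i j = 0 \<or> adj i j = 1"
  by (simp add: adj_def)

lemma adj_diag: "adj i i = 0"
  using edge_card[of "{vs ! i}"] by (auto simp: adj_def)

lemma vertex_degree_eq_deg:
  assumes i: "i < n"
  shows "real (vertex_degree E (vs ! i)) = deg i"
proof -
  let ?J = "{j\<in>{..<n}. {vs ! i, vs ! j} \<in> E}" and ?f = "\<lambda>j. {vs ! i, vs ! j}"
  have inj: "inj_on ?f ?J"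
    using distinct by (auto simp: inj_on_def doubleton_eq_iff n_def nth_eq_iff_index_eq)
  have "{e \<in> E. vs ! i \<in> e} = ?f ` ?J"
  proof (intro equalityI subsetI)
    fix e assume e: "e \<in> {e \<in> E. vs ! i \<in> e}"
    then obtain x where x: "e = {vs ! i, x}"
      using edge_card[of e] by (auto simp: card_2_iff)
    then have "x \<in> set vs" using e edge_card by auto
    then obtain j where "j < n" "x = vs ! j" by (auto simp: in_set_conv_nth n_def)
    then show "e \<in> ?f ` ?J" using e x by auto
  qed auto
  then have "real (vertex_degree E (vs ! i)) = real (card ?J)"
    unfolding vertex_degree_def using inj by (simp add: card_image)
  also have "\<dots> = deg i"
    unfolding deg_def adj_def by (subst sum.If_cases) (auto intro!: arg_cong[of _ _ card])
  finally show ?thesis .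
qed

lemma sum_deg: "(\<Sum>i<n. deg i) = 2 * real (card E)"
proof -
  have "(\<Sum>i<n. deg i) = (\<Sum>i<n. real (vertex_degree E (vs ! i)))"
    by (simp add: vertex_degree_eq_deg)
  also have "\<dots> = (\<Sum>v\<in>set vs. real (vertex_degree E v))"
    by (intro sum.reindex_bij_betw bij_betw_nth) (auto simp: distinct n_def)
  also have "\<dots> = (\<Sum>v\<in>set vs. \<Sum>e\<in>E. if v \<in> e then 1 else 0)"
    unfolding vertex_degree_def by (simp add: sum.If_cases finite_edges Int_def)
  also have "\<dots> = (\<Sum>e\<in>E. \<Sum>v\<in>set vs. if v \<in> e then 1 else 0)"
    by (rule sum.swap)
  also have "\<dots> = (\<Sum>e\<in>E. 2)"
  proof (rule sum.cong[OF refl])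
    fix e assume "e \<in> E"
    then have "set vs \<inter> {v. v \<in> e} = e" "card e = 2" using edge_card by auto
    then show "(\<Sum>v\<in>set vs. if v \<in> e then 1 else 0) = (2::real)"
      by (subst sum.If_cases) auto
  qed
  finally show ?thesis by simp
qed

section \<open>Entries of the Laplacian and of the density matrix\<close>

lemma laplacian_carrier: "laplacian vs E \<in> carrier_mat n n"
  by (simp add: laplacian_def adjacency_matrix_def n_def minus_carrier_mat)

lemma laplacian_index:
  assumes "i < n" "j < n"
  shows "laplacian vs E $$ (i, j) = (if i = j then deg i else 0) - adj i j"
  using assms vertex_degree_eq_deg
  by (simp add: laplacian_def degree_matrix_def adjacency_matrix_def n_def adj_def)

lemma mat_trace_laplacian: "mat_trace (laplacian vs E) = 2 * real (card E)"
  using laplacian_carrier by (simp add: mat_trace_def laplacian_index adj_diag sum_deg)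

lemma density_matrix_carrier: "density_matrix vs E \<in> carrier_mat n n"
  using laplacian_carrier by (simp add: density_matrix_def)

lemma density_matrix_index:
  assumes "i < n" "j < n"
  shows "density_matrix vs E $$ (i, j) = ((if i = j then deg i else 0) - adj i j) / (2 * real (card E))"
  using assms laplacian_carrier
  by (simp add: density_matrix_def laplacian_index mat_trace_laplacian)

lemma density_matrix_sym: "transpose_mat (density_matrix vs E) = density_matrix vs E"
  using density_matrix_carrier
  by (intro eq_matI) (auto simp: density_matrix_index adj_sym)

section \<open>Moments and nonnegativity of the spectrum\<close>

lemma sum_eigenvalues:
  assumes "E \<noteq> {}"
  shows "(\<Sum>x\<in>#graph_eigenvalues vs E. x) = 1"
proof -
  have "card E > 0" using assms finite_edges by (simp add: card_gt_0_iff)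
  then show ?thesis
    using density_matrix_carrier
    unfolding graph_eigenvalues_def
      symmetric_proots_sums(1)[OF density_matrix_carrier density_matrix_sym]
    by (simp add: mat_trace_def density_matrix_index adj_diag sum_deg flip: sum_divide_distrib)
qed

text \<open>This is the squared Frobenius norm of the density matrix. Diagonal and adjacency parts
  never overlap, and squaring leaves 0/1 entries unchanged, so the off-diagonal part contributes the
  sum of the degrees. Without edges both sides are 0, because division by 0 yields 0.\<close>

lemma sum_eigenvalues_squared:
  "(\<Sum>x\<in>#graph_eigenvalues vs E. x\<^sup>2)
     = ((\<Sum>i<n. (deg i)\<^sup>2) + 2 * real (card E)) / (2 * real (card E))\<^sup>2"
proof -
  have "(\<Sum>i<n. \<Sum>j<n. (density_matrix vs E $$ (i, j))\<^sup>2)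
      = (\<Sum>i<n. \<Sum>j<n. ((if i = j then (deg i)\<^sup>2 else 0) + adj i j) / (2 * real (card E))\<^sup>2)"
  proof (intro sum.cong refl)
    fix i j assume "i \<in> {..<n}" "j \<in> {..<n}"
    then show "(density_matrix vs E $$ (i, j))\<^sup>2
        = ((if i = j then (deg i)\<^sup>2 else 0) + adj i j) / (2 * real (card E))\<^sup>2"
      using adj_zero_one[of i j] by (auto simp: density_matrix_index power_divide adj_diag)
  qed
  also have "\<dots> = (\<Sum>i<n. ((deg i)\<^sup>2 + deg i) / (2 * real (card E))\<^sup>2)"
    by (simp add: sum.distrib deg_def flip: sum_divide_distrib)
  also have "\<dots> = ((\<Sum>i<n. (deg i)\<^sup>2) + 2 * real (card E)) / (2 * real (card E))\<^sup>2"
    by (simp add: sum.distrib sum_deg flip: sum_divide_distrib)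
  finally show ?thesis
    unfolding graph_eigenvalues_def
      symmetric_proots_sums(2)[OF density_matrix_carrier density_matrix_sym] .
qed

text \<open>Clearing the trace leaves the Laplacian in difference form. This form gives both the
  quadratic form behind \<open>eigenvalue_nonneg\<close> and the explicit equations for the
  star.\<close>

lemma eigenvalue_equations:
  assumes "E \<noteq> {}" and x: "x \<in># graph_eigenvalues vs E"
  obtains v where "\<exists>i<n. v i \<noteq> 0"
    and "\<And>i. i < n \<Longrightarrow> (\<Sum>j<n. adj i j * (v i - v j)) = 2 * real (card E) * x * v i"
proof -
  have m: "card E > 0" using assms finite_edges by (simp add: card_gt_0_iff)
  obtain v where "eigenvector (density_matrix vs E) v x"
    using in_proots_char_poly_eigenvector[OF density_matrix_carrier x[unfolded graph_eigenvalues_def]] .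
  then have v: "dim_vec v = n" "v \<noteq> 0\<^sub>v n" and eq: "density_matrix vs E *\<^sub>v v = x \<cdot>\<^sub>v v"
    using density_matrix_carrier by (auto simp: eigenvector_def)
  have "\<exists>i<n. v $ i \<noteq> 0"
    using v by (metis eq_vecI index_zero_vec)
  moreover have "(\<Sum>j<n. adj i j * (v $ i - v $ j)) = 2 * real (card E) * x * v $ i" if i: "i < n" for i
  proof -
    have "x * v $ i = (\<Sum>j<n. density_matrix vs E $$ (i, j) * v $ j)"
      using arg_cong[OF eq, of "\<lambda>w. w $ i"] i v density_matrix_carrier
      by (auto simp: scalar_prod_def lessThan_atLeast0)
    also have "\<dots> = (\<Sum>j<n. ((if i = j then deg i * v $ i else 0) - adj i j * v $ j) / (2 * real (card E)))"
      using i by (intro sum.cong refl) (auto simp: density_matrix_index algebra_simps)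
    also have "\<dots> = (deg i * v $ i - (\<Sum>j<n. adj i j * v $ j)) / (2 * real (card E))"
      using i by (simp add: sum_subtractf flip: sum_divide_distrib)
    also have "\<dots> = (\<Sum>j<n. adj i j * (v $ i - v $ j)) / (2 * real (card E))"
      by (simp add: deg_def sum_distrib_right sum_subtractf right_diff_distrib)
    finally show ?thesis using m by (simp add: field_simps)
  qed
  ultimately show thesis by (rule that)
qed

text \<open>Pairing the eigenvalue equations with \<open>v\<close> and symmetrizing in
  \<open>i\<close> and \<open>j\<close> gives twice the Laplacian quadratic form as a sum of the
  squares \<open>(v i - v j)\<^sup>2\<close> over adjacent pairs.\<close>

lemma eigenvalue_nonneg:
  assumes "E \<noteq> {}" and x: "x \<in># graph_eigenvalues vs E"
  shows "x \<ge> 0"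
proof -
  have m: "card E > 0" using assms finite_edges by (simp add: card_gt_0_iff)
  obtain v where v: "\<exists>i<n. v i \<noteq> 0"
    and eq: "\<And>i. i < n \<Longrightarrow> (\<Sum>j<n. adj i j * (v i - v j)) = 2 * real (card E) * x * v i"
    using eigenvalue_equations[OF assms] by blast
  define T where "T = (\<Sum>i<n. \<Sum>j<n. adj i j * (v i - v j) * v i)"
  have T: "T = 2 * real (card E) * x * (\<Sum>i<n. (v i)\<^sup>2)"
    unfolding T_def sum_distrib_left
    by (intro sum.cong refl) (simp add: sum_distrib_right[symmetric] eq power2_eq_square)
  have "T = (\<Sum>i<n. \<Sum>j<n. adj i j * (v j - v i) * v j)"
    unfolding T_def by (subst sum.swap) (simp add: adj_sym)
  then have "2 * T = (\<Sum>i<n. \<Sum>j<n. adj i j * (v i - v j) * v i + adj i j * (v j - v i) * v j)"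
    by (simp add: T_def sum.distrib)
  also have "\<dots> = (\<Sum>i<n. \<Sum>j<n. adj i j * (v i - v j)\<^sup>2)"
    by (intro sum.cong refl) (simp add: algebra_simps power2_eq_square)
  also have "\<dots> \<ge> 0" by (intro sum_nonneg) (simp add: adj_def)
  finally have "0 \<le> 2 * real (card E) * (\<Sum>i<n. (v i)\<^sup>2) * x"
    using T by (simp add: mult_ac)
  moreover have "(\<Sum>i<n. (v i)\<^sup>2) > 0"
    using v by (auto intro!: sum_pos2)
  then have "2 * real (card E) * (\<Sum>i<n. (v i)\<^sup>2) > 0" using m by simp
  ultimately show ?thesis by (simp only: zero_le_mult_iff) linarith
qed

section \<open>Entropy bounds for a general graph\<close>

lemma renyi_2_le_von_neumann:
  assumes "E \<noteq> {}"
  shows "renyi_2_entropy vs E \<le> von_neumann_entropy vs E"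
proof -
  let ?X = "graph_eigenvalues vs E"
  define s where "s = (\<Sum>x\<in>#?X. x\<^sup>2)"
  have "card E > 0" using assms finite_edges by (simp add: card_gt_0_iff)
  then have s: "s > 0"
    unfolding s_def sum_eigenvalues_squared by (auto intro!: divide_pos_pos add_nonneg_pos sum_nonneg)
  \<comment> \<open>The tangent of the logarithm at \<open>s\<close>, multiplied by
    \<open>x\<close>. After summation the correction vanishes, since the squares sum to
    \<open>s\<close> and the eigenvalues to 1, leaving exactly \<open>log 2 s\<close>.\<close>
  have "x * log 2 x \<le> (x\<^sup>2 / s - x) / ln 2 + x * log 2 s" if "x \<in># ?X" for x
  proof (cases "x = 0")
    case False
    then have x: "x > 0" using eigenvalue_nonneg[OF assms that] by simp
    then have "ln x - ln s \<le> x / s - 1"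
      using ln_le_minus_one[of "x / s"] s by (simp add: ln_div)
    then have "x * (ln x - ln s) \<le> x * (x / s - 1)"
      using x by (intro mult_left_mono) auto
    then have "x * (ln x - ln s) / ln 2 \<le> x * (x / s - 1) / ln 2"
      by (intro divide_right_mono) auto
    then show ?thesis
      by (simp add: log_def power2_eq_square diff_divide_distrib algebra_simps)
  qed simp
  then have "(\<Sum>x\<in>#?X. x * log 2 x) \<le> (\<Sum>x\<in>#?X. (x\<^sup>2 / s - x) / ln 2 + x * log 2 s)"
    by (rule sum_mset_mono)
  also have "\<dots> = (\<Sum>x\<in>#?X. (1 / (s * ln 2)) * x\<^sup>2 + (log 2 s - 1 / ln 2) * x)"
    by (simp add: algebra_simps diff_divide_distrib)
  also have "\<dots> = log 2 s"
    using s sum_eigenvalues[OF assms]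
    by (simp only: sum_mset.distrib sum_mset_distrib_left[symmetric] s_def[symmetric]) simp
  finally show ?thesis
    by (simp add: renyi_2_entropy_def von_neumann_entropy_def s_def)
qed

lemma sum_eigenvalues_squared_le:
  assumes "n \<ge> 2" and "density_condition n (card E)"
  shows "(\<Sum>x\<in>#graph_eigenvalues vs E. x\<^sup>2) \<le> sqrt (real n) / (2 * (real n - 1))"
    and "E \<noteq> {}"
proof -
  define m where "m = real (card E)"
  have N: "real (n choose 2) = real n * (real n - 1) / 2"
    using assms(1) by (simp add: choose_two real_of_nat_div)
  have q: "sqrt (real n) > 1" using assms by simp
  have "1 / (sqrt (real n) - 1) \<le> m / (real n * (real n - 1) / 2)"
    using assms(2) by (simp only: density_condition_def N m_def)
  then have *: "real n * (real n - 1) \<le> 2 * m * (sqrt (real n) - 1)"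
    using assms(1) q by (simp add: field_simps)
  moreover have "real n * (real n - 1) > 0" using assms(1) by simp
  ultimately have "m \<noteq> 0" by auto
  then have m: "m > 0" by (simp add: m_def)
  then show "E \<noteq> {}" by (auto simp: m_def)
  let ?D = "\<Sum>i<n. (deg i)\<^sup>2"
  have "2 * (real n - 1) * ?D \<le> 2 * m * (2 * m + (real n - 1) * (real n - 2))"
    using sum_squared_degrees_le[of adj deg n "2 * m"] adj_sym adj_zero_one adj_diag deg_def sum_deg
    by (simp add: m_def)
  then have "2 * (real n - 1) * (?D + 2 * m) \<le> 4 * m\<^sup>2 + 2 * m * (real n * (real n - 1))"
    by (simp add: algebra_simps power2_eq_square)
  \<comment> \<open>The density condition enters here as \<open>*\<close>. The \<open>- 1\<close>
    next to the square root cancels the term \<open>4 * m\<^sup>2\<close> that de Caen's inequality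
    leaves.\<close>
  also have "\<dots> \<le> 4 * m\<^sup>2 + 2 * m * (2 * m * (sqrt (real n) - 1))"
    using * m by (intro add_left_mono mult_left_mono) auto
  also have "\<dots> = sqrt (real n) * (2 * m)\<^sup>2"
    by (simp add: algebra_simps power2_eq_square)
  finally have "2 * (real n - 1) * (?D + 2 * m) \<le> sqrt (real n) * (2 * m)\<^sup>2" .
  moreover have "2 * (real n - 1) > 0" "(2 * m)\<^sup>2 > 0" using assms(1) m by auto
  ultimately have "(?D + 2 * m) / (2 * m)\<^sup>2 \<le> sqrt (real n) / (2 * (real n - 1))"
    by (simp only: pos_divide_le_eq pos_le_divide_eq times_divide_eq_left)
      (simp add: mult_ac)
  then show "(\<Sum>x\<in>#graph_eigenvalues vs E. x\<^sup>2) \<le> sqrt (real n) / (2 * (real n - 1))"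
    by (simp only: sum_eigenvalues_squared m_def)
qed

text \<open>The left-hand side is the value separating the two entropies:
  \<open>von_neumann_entropy_star_le\<close> bounds the star's entropy above by the same
  expression.\<close>

lemma renyi_2_ge:
  assumes "n \<ge> 2" and "density_condition n (card E)"
  shows "log 2 (2 * (real n - 1)) - log 2 (real n) / 2 \<le> renyi_2_entropy vs E"
proof -
  let ?s = "\<Sum>x\<in>#graph_eigenvalues vs E. x\<^sup>2"
  note le = sum_eigenvalues_squared_le[OF assms]
  have "card E > 0" using le(2) finite_edges by (simp add: card_gt_0_iff)
  then have s: "?s > 0"
    unfolding sum_eigenvalues_squared by (auto intro!: divide_pos_pos add_nonneg_pos sum_nonneg)
  have "log 2 ?s \<le> log 2 (sqrt (real n) / (2 * (real n - 1)))"
    using s le(1) assms(1) by (subst log_le_cancel_iff) auto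
  also have "\<dots> = log 2 (real n) / 2 - log 2 (2 * (real n - 1))"
    using assms(1) by (simp add: log_divide_pos powr_half_sqrt[symmetric] log_powr)
  finally show ?thesis by (simp add: renyi_2_entropy_def)
qed

end

subsection \<open>The star\<close>

text \<open>On the possible Laplacian eigenvalues \<open>y \<in> {0, 1, n}\<close> of the star, \<open>y log y\<close> agrees with the
  quadratic \<open>y (y - 1) log n / (n - 1)\<close>. The entropy of the star is thus determined by the first two
  moments of the spectrum, and multiplicities are never needed.\<close>

lemma von_neumann_entropy_star:
  fixes n :: nat
  assumes n: "n \<ge> 2"
  shows "von_neumann_entropy [1..<Suc n] (star_edges n)
    = log 2 (2 * (real n - 1)) - real n / (2 * (real n - 1)) * log 2 (real n)"
proof -
  define vs where "vs = [1..<Suc n]"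
  let ?E = "star_edges n"
  have edges: "?E = (\<lambda>v. {1, v}) ` {2..n}" by (auto simp: star_edges_def)
  interpret G: ordered_graph vs ?E
    by unfold_locales (auto simp: vs_def simple_graph_def edges card_insert_if)
  have Gn: "G.n = n" unfolding G.n_def by (simp add: vs_def)
  have "inj_on (\<lambda>v. {1, v}) {2..n}" by (auto simp: inj_on_def doubleton_eq_iff)
  then have "card ?E = n - 1" unfolding edges by (simp add: card_image)
  then have m: "real (card ?E) = real n - 1" using n by simp
  then have ne: "?E \<noteq> {}" using n by auto
  \<comment> \<open>The centre, vertex \<open>1\<close>, has index \<open>0\<close> in
    \<open>vs\<close>; the leaves have the indices from \<open>1\<close> to
    \<open>n - 1\<close>.\<close>
  have adj: "G.adj i j = (if i = 0 \<and> j \<noteq> 0 \<or> i \<noteq> 0 \<and> j = 0 then 1 else 0)" if "i < n" "j < n" for i j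
    using that unfolding G.adj_def unfolding edges vs_def
    by (auto simp: doubleton_eq_iff image_iff simp del: upt_Suc)
  have centre: "(\<Sum>j<n. G.adj 0 j * f j) = (\<Sum>j\<in>{1..<n}. f j)" for f
    using n by (intro sum.mono_neutral_cong_right) (auto simp: adj)
  have leaf: "(\<Sum>j<n. G.adj i j * f j) = f 0" if "0 < i" "i < n" for i f
    using that by (subst sum.remove[of _ 0]) (auto simp: adj intro!: sum.neutral)
  have deg0: "G.deg 0 = real n - 1"
    using centre[of "\<lambda>_. 1"] n by (simp add: G.deg_def Gn)
  have deg1: "G.deg i = 1" if "0 < i" "i < n" for i
    using leaf[OF that, of "\<lambda>_. 1"] by (simp add: G.deg_def Gn)
  have "(\<Sum>i<n. (G.deg i)\<^sup>2) = (\<Sum>i\<in>{..<n} - {0}. 1) + (real n - 1)\<^sup>2"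
    using n deg0 deg1 by (subst sum.remove[of _ 0]) auto
  also have "\<dots> = (real n - 1) * real n"
    using n by (simp add: power2_eq_square algebra_simps)
  finally have "(\<Sum>x\<in>#graph_eigenvalues vs ?E. x\<^sup>2)
      = ((real n - 1) * real n + 2 * (real n - 1)) / (2 * (real n - 1))\<^sup>2"
    by (simp only: G.sum_eigenvalues_squared Gn m)
  also have "\<dots> = (real n + 2) / (4 * (real n - 1))"
    using n by (simp add: divide_simps) (simp add: algebra_simps power2_eq_square)
  finally have squares: "(\<Sum>x\<in>#graph_eigenvalues vs ?E. x\<^sup>2) = (real n + 2) / (4 * (real n - 1))" .
  define t where "t = 2 * (real n - 1)"
  have t: "t > 0" using n by (simp add: t_def)
  \<comment> \<open>For \<open>y = t * x\<close> different from 1, the leaf equations make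
    \<open>v\<close> constant on the leaves, with value \<open>v 0 / (1 - y)\<close>, and force
    \<open>v 0\<close> to be nonzero. The equation at the centre then reduces to
    \<open>y * (y - n) = 0\<close>.\<close>
  have spectrum: "t * x \<in> {0, 1, real n}" if x: "x \<in># graph_eigenvalues vs ?E" for x
  proof (rule ccontr)
    assume not: "t * x \<notin> {0, 1, real n}"
    define y where "y = t * x"
    obtain v where v: "\<exists>i<n. v i \<noteq> 0"
      and eq: "\<And>i. i < n \<Longrightarrow> (\<Sum>j<n. G.adj i j * (v i - v j)) = y * v i"
      using G.eigenvalue_equations[OF ne x] unfolding Gn m y_def t_def by blast
    have vi: "v i = v 0 / (1 - y)" if "0 < i" "i < n" for i
    proof -
      have "v i - v 0 = y * v i" using eq[of i] leaf[OF that] that by simp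
      moreover have "1 - y \<noteq> 0" using not by (simp add: y_def)
      ultimately show ?thesis by (simp add: field_simps)
    qed
    have v0: "v 0 \<noteq> 0"
      using v vi by (metis div_0 gr0I)
    have "y * v 0 = (\<Sum>j\<in>{1..<n}. v 0 - v j)"
      using eq[of 0] centre n by simp
    also have "\<dots> = (\<Sum>j\<in>{1..<n}. v 0 - v 0 / (1 - y))"
      by (intro sum.cong refl) (simp add: vi)
    also have "\<dots> = v 0 * ((real n - 1) * (1 - 1 / (1 - y)))"
      using n by (simp add: algebra_simps)
    finally have "y = (real n - 1) * (1 - 1 / (1 - y))"
      using v0 by simp
    then have "y * (y - real n) = 0"
      using not by (simp add: y_def[symmetric] field_simps)
    then show False using not by (simp add: y_def)
  qed
  \<comment> \<open>The quadratic interpolating \<open>y log y\<close> is rewritten for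
    \<open>x = y / t\<close>; the rescaling produces the extra term
    \<open>- log 2 t\<close>.\<close>
  have "x * log 2 x = (log 2 (real n) / (real n - 1) * t) * x\<^sup>2
      + (- log 2 (real n) / (real n - 1) - log 2 t) * x"
    if x: "x \<in># graph_eigenvalues vs ?E" for x
  proof (cases "x = 0")
    case False
    define y where "y = t * x"
    have xpos: "x > 0" using False G.eigenvalue_nonneg[OF ne x] by simp
    have "y = 1 \<or> y = real n"
      using spectrum[OF x] False t by (auto simp: y_def)
    then have "log 2 y = log 2 (real n) / (real n - 1) * (y - 1)"
      using n by auto
    moreover have "log 2 y = log 2 t + log 2 x"
      using t xpos by (simp add: y_def log_mult_pos)
    ultimately have "log 2 x = log 2 (real n) / (real n - 1) * (t * x - 1) - log 2 t"
      by (simp add: y_def)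
    then have "x * log 2 x = x * (log 2 (real n) / (real n - 1) * (t * x - 1) - log 2 t)"
      by simp
    then show ?thesis by (simp add: power2_eq_square algebra_simps diff_divide_distrib)
  qed simp
  then have "(\<Sum>x\<in>#graph_eigenvalues vs ?E. x * log 2 x)
      = (\<Sum>x\<in>#graph_eigenvalues vs ?E. (log 2 (real n) / (real n - 1) * t) * x\<^sup>2
          + (- log 2 (real n) / (real n - 1) - log 2 t) * x)"
    by (intro arg_cong[of _ _ sum_mset] image_mset_cong)
  also have "\<dots> = (log 2 (real n) / (real n - 1) * t) * ((real n + 2) / (4 * (real n - 1)))
      + (- log 2 (real n) / (real n - 1) - log 2 t) * 1"
    by (simp only: sum_mset.distrib sum_mset_distrib_left[symmetric] squares G.sum_eigenvalues[OF ne])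
  also have "\<dots> = real n / (2 * (real n - 1)) * log 2 (real n) - log 2 t"
  proof -
    have *: "L / N * (2 * N) * ((k + 2) / (4 * N)) + (- L / N - T) * 1 = k / (2 * N) * L - T"
      if "N \<noteq> 0" for L N T k :: real
      using that by (simp add: field_simps)
    show ?thesis
      unfolding t_def by (rule *) (use n in simp)
  qed
  finally show ?thesis by (simp add: von_neumann_entropy_def t_def vs_def)
qed

text \<open>The coefficient of \<open>log 2 (real n)\<close> is only coarsened, from
  \<open>n / (2 * (n - 1))\<close> down to \<open>1 / 2\<close>, to match
  \<open>renyi_2_ge\<close>.\<close>

lemma von_neumann_entropy_star_le:
  fixes n :: nat
  assumes n: "n \<ge> 2"
  shows "von_neumann_entropy [1..<Suc n] (star_edges n) \<le> log 2 (2 * (real n - 1)) - log 2 (real n) / 2"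
proof -
  have "1 / 2 \<le> real n / (2 * (real n - 1))" using n by (simp add: field_simps)
  then have "1 / 2 * log 2 (real n) \<le> real n / (2 * (real n - 1)) * log 2 (real n)"
    using n by (intro mult_right_mono) auto
  then show ?thesis unfolding von_neumann_entropy_star[OF n] by simp
qed

subsection \<open>Most graphs are dense\<close>

text \<open>Up to scaling, the variance of the size of a uniformly random subset. Adding an element
  \<open>x\<close> replaces each deviation by itself plus 1 and minus 1, according to whether
  \<open>x\<close> is left out or included, and the two squares sum to twice the old square plus
  2.\<close>

lemma sum_Pow_squared_deviation:
  assumes "finite A"
  shows "(\<Sum>B\<in>Pow A. (real (card A) - 2 * real (card B))\<^sup>2) = real (card A) * 2 ^ card A"
  using assms
proof (induction A)
  case (insert x A)
  have inj: "inj_on (insert x) (Pow A)"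
    using insert.hyps by (auto simp: inj_on_def)
  have "(\<Sum>B\<in>Pow (insert x A). (real (card (insert x A)) - 2 * real (card B))\<^sup>2)
      = (\<Sum>B\<in>Pow A. (real (card (insert x A)) - 2 * real (card B))\<^sup>2)
        + (\<Sum>B\<in>Pow A. (real (card (insert x A)) - 2 * real (card (insert x B)))\<^sup>2)"
    unfolding Pow_insert using insert.hyps inj
    by (subst sum.union_disjoint) (auto simp: sum.reindex)
  also have "\<dots> = (\<Sum>B\<in>Pow A. (real (card A) + 1 - 2 * real (card B))\<^sup>2)
        + (\<Sum>B\<in>Pow A. (real (card A) - 1 - 2 * real (card B))\<^sup>2)"
  proof (intro arg_cong2[of _ _ _ _ "(+)"] sum.cong refl)
    fix B assume "B \<in> Pow A"
    then have "card (insert x B) = Suc (card B)"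
      using insert.hyps by (subst card_insert_disjoint) (auto intro: finite_subset)
    then show "(real (card (insert x A)) - 2 * real (card (insert x B)))\<^sup>2
        = (real (card A) - 1 - 2 * real (card B))\<^sup>2"
      using insert.hyps by (simp add: power2_eq_square algebra_simps)
  qed (use insert.hyps in \<open>simp add: add_ac\<close>)
  also have "\<dots> = (\<Sum>B\<in>Pow A. 2 * (real (card A) - 2 * real (card B))\<^sup>2 + 2)"
    unfolding sum.distrib[symmetric]
    by (intro sum.cong refl) (simp add: power2_eq_square algebra_simps)
  also have "\<dots> = real (card (insert x A)) * 2 ^ card (insert x A)"
    using insert by (simp add: sum.distrib card_Pow algebra_simps flip: sum_distrib_left)
  finally show ?case .
qed simp

text \<open>Chebyshev's inequality: a set counted here has deviation
  \<open>card A - 2 * card B\<close> above \<open>card A / 3\<close>.\<close>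

lemma card_small_subsets_le:
  assumes "finite A"
  shows "real (card {B. B \<subseteq> A \<and> 3 * card B < card A}) * real (card A) \<le> 9 * 2 ^ card A"
proof (cases "card A = 0")
  case False
  let ?S = "{B. B \<subseteq> A \<and> 3 * card B < card A}"
  have "real (card ?S) * (real (card A) / 3)\<^sup>2 = (\<Sum>B\<in>?S. (real (card A) / 3)\<^sup>2)" by simp
  also have "\<dots> \<le> (\<Sum>B\<in>?S. (real (card A) - 2 * real (card B))\<^sup>2)"
    by (intro sum_mono power_mono) auto
  also have "\<dots> \<le> (\<Sum>B\<in>Pow A. (real (card A) - 2 * real (card B))\<^sup>2)"
    using assms by (intro sum_mono2) auto
  also have "\<dots> = real (card A) * 2 ^ card A" by (rule sum_Pow_squared_deviation[OF assms])
  finally have "real (card A) * (real (card ?S) * real (card A)) \<le> real (card A) * (9 * 2 ^ card A)"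
    by (simp add: power2_eq_square field_simps)
  then show ?thesis using False by (simp only: mult_le_cancel_left_pos of_nat_0_less_iff neq0_conv)
qed simp

text \<open>From \<open>n = 16\<close> on, the square root is at least 4, so the density threshold
  is at most one third.\<close>

lemma dense_if_third:
  assumes "n \<ge> 16" "n choose 2 \<le> 3 * m"
  shows "density_condition n m"
proof -
  have "sqrt (real n) \<ge> 4" using assms(1) by (intro real_le_rsqrt) simp
  then have "1 / (sqrt (real n) - 1) \<le> 1 / 3" by (intro frac_le) auto
  also have "real (n choose 2) \<le> real (3 * m)" using assms(2) by (simp only: of_nat_le_iff)
  then have "1 / 3 \<le> real m / real (n choose 2)"
    using assms(1) by (simp add: field_simps)
  finally show ?thesis by (simp add: density_condition_def)
qed

lemma almost_all_graphs_dense: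
  "(\<lambda>n::nat. real (card {E. simple_graph {1..n} E \<and> density_condition n (card E)})
             / real (card {E. simple_graph {1..n} E})) \<longlonglongrightarrow> 1"
    (is "?r \<longlonglongrightarrow> 1")
proof (rule tendsto_sandwich)
  define P where "P n = {e. e \<subseteq> {1..n} \<and> card e = 2}" for n :: nat
  have fin: "finite (P n)" for n by (simp add: P_def)
  have cardP: "card (P n) = n choose 2" for n
    using n_subsets[of "{1..n}" 2] by (simp add: P_def)
  have graphs: "{E. simple_graph {1..n} E} = Pow (P n)" for n
    by (auto simp: simple_graph_def P_def)
  have total: "card {E. simple_graph {1..n} E} = 2 ^ (n choose 2)" for n
    unfolding graphs using fin[of n] by (simp add: card_Pow cardP)
  have fin_graphs: "finite {E. simple_graph {1..n} E}" for n :: nat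
    unfolding graphs using fin by simp
  show "\<forall>\<^sub>F n in sequentially. ?r n \<le> 1"
    using fin_graphs by (intro always_eventually allI) (auto simp: divide_le_eq intro!: card_mono)
  show "\<forall>\<^sub>F n in sequentially. 1 - 9 / (real n - 1) \<le> ?r n"
    using eventually_ge_at_top[of 16]
  proof eventually_elim
    case (elim n)
    let ?N = "n choose 2"
    let ?G = "{E. simple_graph {1..n} E}" and ?S = "{B. B \<subseteq> P n \<and> 3 * card B < card (P n)}"
    let ?D = "{E. simple_graph {1..n} E \<and> density_condition n (card E)}"
    \<comment> \<open>Bounding the number of possible edges below by \<open>n - 1\<close> weakens
      the rate of convergence but suffices for the limit.\<close>
    have "?N = n * (n - 1) div 2" by (rule choose_two)
    moreover have "2 * (n - 1) \<le> n * (n - 1)" using elim by (intro mult_right_mono) auto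
    ultimately have N: "n - 1 \<le> ?N" by linarith
    \<comment> \<open>By \<open>dense_if_third\<close>, a graph outside \<open>?D\<close> has fewer
      than a third of all possible edges and so belongs to \<open>?S\<close>.\<close>
    have "?G \<subseteq> ?D \<union> ?S"
      unfolding graphs cardP using dense_if_third[OF elim] by (auto simp: not_less[symmetric] simple_graph_def P_def)
    then have "card ?G \<le> card (?D \<union> ?S)"
      using fin_graphs[of n] fin[of n] by (intro card_mono) auto
    also have "\<dots> \<le> card ?D + card ?S" by (rule card_Un_le)
    finally have "real (card ?G) - real (card ?S) \<le> real (card ?D)" by linarith
    moreover have "real (card ?S) * (real n - 1) \<le> real (card ?S) * real ?N"
      using N elim by (intro mult_left_mono) auto
    then have "real (card ?S) * (real n - 1) \<le> 9 * real (card ?G)"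
      using card_small_subsets_le[OF fin[of n]] unfolding total cardP by simp
    then have "real (card ?S) \<le> 9 / (real n - 1) * real (card ?G)"
      using elim by (simp add: field_simps)
    ultimately have "(1 - 9 / (real n - 1)) * real (card ?G) \<le> real (card ?D)"
      by (simp add: algebra_simps)
    then show ?case unfolding total by (simp add: field_simps)
  qed
  show "(\<lambda>n. 1 - 9 / (real n - 1)) \<longlonglongrightarrow> 1" by real_asymp
qed simp

theorem theorem2p3:
  shows "(\<forall>(n::nat) (V :: 'a set) (E :: 'a set set) (vs :: 'a list).
            n \<ge> 2 \<longrightarrow> simple_graph V E \<longrightarrow> card V = n \<longrightarrow> distinct vs \<longrightarrow> set vs = V \<longrightarrow>
            density_condition n (card E) \<longrightarrow>
            von_neumann_entropy vs E \<ge> renyi_2_entropy vs E \<and>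
            renyi_2_entropy vs E \<ge> von_neumann_entropy [1..<Suc n] (star_edges n))
       \<and> (\<lambda>n::nat. real (card {E. simple_graph {1..n} E \<and> density_condition n (card E)})
                   / real (card {E. simple_graph {1..n} E})) \<longlonglongrightarrow> 1"
proof (intro conjI[OF _ almost_all_graphs_dense] allI impI)
  fix n :: nat and V :: "'a set" and E :: "'a set set" and vs :: "'a list"
  assume n: "n \<ge> 2" and G: "simple_graph V E" "card V = n" "distinct vs" "set vs = V"
    and dense: "density_condition n (card E)"
  interpret G: ordered_graph vs E using G by unfold_locales auto
  have Gn: "G.n = n" using G by (auto simp: G.n_def distinct_card)
  note dense' = n[folded Gn] dense[folded Gn]
  show "von_neumann_entropy vs E \<ge> renyi_2_entropy vs E \<and>
      renyi_2_entropy vs E \<ge> von_neumann_entropy [1..<Suc n] (star_edges n)"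
    using G.renyi_2_le_von_neumann[OF G.sum_eigenvalues_squared_le(2)[OF dense']]
      G.renyi_2_ge[OF dense'] von_neumann_entropy_star_le[OF n]
    by (simp add: Gn)
qed

end
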